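(* Let $1\le p\le n-1$ be integers and $0\le\alpha\le1$. The generalised distance spectrum of the firefly-type graph $F_{p,n-p}$ (the multiset of eigenvalues of $D_\alpha(F_{p,n-p})$, superscripts denoting multiplicities) is $$\operatorname{Spec}_{D_\alpha}(F_{p,n-p})=\Big\{((4n-2p+1)\alpha-2)^{p-1},\ ((4n-2p-1)\alpha-1)^{n-p},\ ((4n-2p+1)\alpha-3)^{n-p-1},\ \lambda_1,\lambda_2,\lambda_3\Big\},$$ where $\lambda_1,\lambda_2,\lambda_3$ are the roots (with multiplicity) of the cubic polynomial $$\begin{aligned}p(x)={}&-x^3+\big((6n-3p+2)\alpha+4n-2p-5\big)x^2\\&+\big((-8n^2-2p^2+8np+3p-6n-1)\alpha^2+(-24n^2-6p^2+24np-9p+14n+5)\alpha+10n-3p-6\big)x\\&+\big((32n^3-4p^3-2p^2-48n^2p+24np^2+4np+2p-2n)\alpha^2-(24n^2+4p^2-20np+3p-2n)\alpha+4n-p\big).\end{aligned}$$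
   Context: For a connected graph $\Gamma$ with vertices $v_1,\dots,v_N$, the distance matrix is $D(\Gamma)=(d(v_i,v_j))_{i,j}$, where $d$ is the shortest-path distance; the transmission of $v_i$ is $Tr_i=\sum_{u\in V(\Gamma)}d(u,v_i)$ and $Tr(\Gamma)=\operatorname{diag}(Tr_1,\dots,Tr_N)$. The generalised distance matrix is $D_\alpha(\Gamma)=\alpha\,Tr(\Gamma)+(1-\alpha)D(\Gamma)$, $0\le\alpha\le1$. The firefly-type graph $F_{p,n-p}$ is $K_1\vee\left(pK_1\cup(n-p)K_2\right)$: a single vertex joined to all vertices of the disjoint union of $p$ copies of $K_1$ and $n-p$ copies of $K_2$ (so it has $2n-p+1$ vertices). *)

theory Defs
  imports
    "Graph_Theory.Pair_Digraph"
    "Graph_Theory.Shortest_Path"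
    "Jordan_Normal_Form.Char_Poly"
    "HOL-Library.Multiset"
begin

text \<open>A simple graph is a \<^locale>\<open>pair_graph\<close>: every undirected edge is represented by the two
  arcs between its end points.\<close>

definition complete_graph :: "nat \<Rightarrow> nat pair_pre_digraph" where
  "complete_graph m = \<lparr> pverts = {..<m}, parcs = {(u, v). u < m \<and> v < m \<and> u \<noteq> v} \<rparr>"

definition copies :: "nat \<Rightarrow> 'a pair_pre_digraph \<Rightarrow> (nat \<times> 'a) pair_pre_digraph" where
  "copies m G =
     \<lparr> pverts = {..<m} \<times> pverts G,
       parcs = {((i, u), (i, v)) | i u v. i < m \<and> (u, v) \<in> parcs G} \<rparr>"

definition graph_union ::
    "'a pair_pre_digraph \<Rightarrow> 'b pair_pre_digraph \<Rightarrow> ('a + 'b) pair_pre_digraph" where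
  "graph_union G H =
     \<lparr> pverts = pverts G <+> pverts H,
       parcs = {(Inl u, Inl v) | u v. (u, v) \<in> parcs G} \<union> {(Inr u, Inr v) | u v. (u, v) \<in> parcs H} \<rparr>"

definition graph_join ::
    "'a pair_pre_digraph \<Rightarrow> 'b pair_pre_digraph \<Rightarrow> ('a + 'b) pair_pre_digraph" where
  "graph_join G H =
     \<lparr> pverts = pverts G <+> pverts H,
       parcs = parcs (graph_union G H)
         \<union> {(Inl u, Inr v) | u v. u \<in> pverts G \<and> v \<in> pverts H}
         \<union> {(Inr v, Inl u) | u v. u \<in> pverts G \<and> v \<in> pverts H} \<rparr>"

text \<open>The graph \<open>F\<^bsub>p,q\<^esub>\<close>, that is, the join of \<open>K\<^sub>1\<close> with the disjoint union of \<open>p K\<^sub>1\<close> and \<open>q K\<^sub>2\<close>.\<close>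

definition firefly :: "nat \<Rightarrow> nat \<Rightarrow> (nat + (nat \<times> nat) + (nat \<times> nat)) pair_pre_digraph" where
  "firefly p q =
     graph_join (complete_graph 1)
       (graph_union (copies p (complete_graph 1)) (copies q (complete_graph 2)))"

text \<open>With all weights equal to 1, the cost of a walk is its number of arcs.  In a connected graph
  the infimum over all walks is finite, so \<^const>\<open>real_of_ereal\<close> loses nothing.\<close>

definition graph_dist :: "'a pair_pre_digraph \<Rightarrow> 'a \<Rightarrow> 'a \<Rightarrow> real" where
  "graph_dist G u v = real_of_ereal (wf_digraph.\<mu> (with_proj G) (\<lambda>_. 1) u v)"

definition transmission :: "'a pair_pre_digraph \<Rightarrow> 'a \<Rightarrow> real" where
  "transmission G v = (\<Sum>u\<in>pverts G. graph_dist G u v)"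

text \<open>The list \<open>vs\<close> is the enumeration \<open>v\<^sub>1, \<dots>, v\<^sub>N\<close> of the vertices that indexes rows and columns.\<close>

definition distance_mat :: "'a pair_pre_digraph \<Rightarrow> 'a list \<Rightarrow> real mat" where
  "distance_mat G vs =
     mat (length vs) (length vs) (\<lambda>(i, j). graph_dist G (vs ! i) (vs ! j))"

definition transmission_mat :: "'a pair_pre_digraph \<Rightarrow> 'a list \<Rightarrow> real mat" where
  "transmission_mat G vs = mat_diag (length vs) (\<lambda>i. transmission G (vs ! i))"

definition gen_distance_mat :: "real \<Rightarrow> 'a pair_pre_digraph \<Rightarrow> 'a list \<Rightarrow> real mat" where
  "gen_distance_mat \<alpha> G vs =
     \<alpha> \<cdot>\<^sub>m transmission_mat G vs + (1 - \<alpha>) \<cdot>\<^sub>m distance_mat G vs"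

text \<open>Eigenvalues are taken in the complex numbers and counted with algebraic multiplicity, so an
  \<open>N \<times> N\<close> matrix has exactly \<open>N\<close> of them.\<close>

definition eigenvalue_mset :: "real mat \<Rightarrow> complex multiset" where
  "eigenvalue_mset A = proots (char_poly (map_mat complex_of_real A))"

definition gen_distance_spectrum ::
    "real \<Rightarrow> 'a pair_pre_digraph \<Rightarrow> 'a list \<Rightarrow> complex multiset" where
  "gen_distance_spectrum \<alpha> G vs = eigenvalue_mset (gen_distance_mat \<alpha> G vs)"

definition firefly_cubic :: "real \<Rightarrow> real \<Rightarrow> real \<Rightarrow> real poly" where
  "firefly_cubic n p \<alpha> =
     [: (32*n^3 - 4*p^3 - 2*p^2 - 48*n^2*p + 24*n*p^2 + 4*n*p + 2*p - 2*n) * \<alpha>^2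
          - (24*n^2 + 4*p^2 - 20*n*p + 3*p - 2*n) * \<alpha> + 4*n - p,
        (-8*n^2 - 2*p^2 + 8*n*p + 3*p - 6*n - 1) * \<alpha>^2
          + (-24*n^2 - 6*p^2 + 24*n*p - 9*p + 14*n + 5) * \<alpha> + 10*n - 3*p - 6,
        (6*n - 3*p + 2) * \<alpha> + 4*n - 2*p - 5,
        -1 :]"

end

theory Submission
  imports Defs
begin

text \<open>Any two distinct vertices of \<open>F\<^bsub>p,q\<^esub>\<close>, where \<open>q = n - p\<close>, are at distance 1 or 2,
  because the hub is adjacent to everything (\<open>graph_dist_universal_vertex\<close>).  Hence the entries of
  \<open>D\<^sub>\<alpha>\<close> depend only on the kinds of the two vertices and on whether they coincide or share a
  triangle.  All leaves, and all triangles, are interchangeable, and so are the two outer vertices of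
  each triangle.  The spectrum therefore splits into a part that is constant on hub, leaves and outer
  triangle vertices, and a part that comes from differences of interchangeable vertices.

  To get algebraic multiplicities without treating coinciding eigenvalues separately, the splitting
  is done by a single change of basis, which makes \<open>D\<^sub>\<alpha>\<close> block triangular.  The vertices are arranged
  in a rooted forest: all leaves hang below the leaf number 0, all triangles hang below the triangle
  number 0, and in each triangle the second outer vertex hangs below the first.  The new basis consists
  of the indicator vectors of the subtrees, and the dual basis takes the value at a vertex minus the value
  at its parent (\<open>char_poly_forest_basis\<close>).  The indicators of the three maximal trees span the
  vectors that are constant on each kind of vertex; \<open>D\<^sub>\<alpha>\<close> acts on their span by a \<open>3 \<times> 3\<close> matrix whose
  characteristic polynomial is the negative of the cubic (\<open>char_poly_firefly_quotient\<close>).  Taking the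
  difference of two rows that belong to interchangeable vertices removes almost all entries, so the
  other basis vectors contribute an upper triangular block, with the remaining eigenvalues on its
  diagonal: \<open>p - 1\<close> from the non-root leaves, \<open>q - 1\<close> from the non-root triangles and \<open>q\<close> from the
  second outer vertices (\<open>char_poly_firefly\<close>).\<close>

section \<open>Distances in a graph with a universal vertex\<close>

lemma graph_dist_universal_vertex:
  assumes wf: "pair_wf_digraph G"
    and w: "w \<in> pverts G" "\<And>v. v \<in> pverts G \<Longrightarrow> v \<noteq> w \<Longrightarrow> (w, v) \<in> parcs G \<and> (v, w) \<in> parcs G"
    and u: "u \<in> pverts G" and v: "v \<in> pverts G"
  shows "graph_dist G u v = (if u = v then 0 else if (u, v) \<in> parcs G then 1 else 2)"
proof -
  interpret wf_digraph "with_proj G"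
    using wf wf_digraph_wp_iff by blast
  let ?d = "if u = v then 0 else if (u, v) \<in> parcs G then 1 else 2 :: real"
  have cost: "awalk_cost (\<lambda>_. 1) es = length es" for es :: "('a \<times> 'a) list"
    by (induct es) auto
  \<comment> \<open>A walk with at least two arcs satisfies the bound trivially; shorter walks determine \<open>u\<close> and \<open>v\<close>.\<close>
  have lower: "?d \<le> length es" if "awalk u es v" for es
  proof (cases es rule: remdups_adj.cases)
    case (3 e e' es')
    then show ?thesis by auto
  qed (use that in \<open>auto simp: awalk_simps\<close>)
  have "\<exists>es. awalk u es v \<and> length es = ?d"
  proof (cases "u = v \<or> (u, v) \<in> parcs G")
    case True
    then show ?thesis
      using u v by (cases "u = v") (auto simp: awalk_simps intro!: exI[of _ "[]"] exI[of _ "[(u, v)]"])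
  next
    case False
    then have "u \<noteq> w" "v \<noteq> w"
      using w u v by auto
    then have "awalk u [(u, w), (w, v)] v"
      using w u v by (auto simp: awalk_simps)
    then show ?thesis
      using False by (intro exI[of _ "[(u, w), (w, v)]"]) auto
  qed
  then obtain es where es: "awalk u es v" "length es = ?d" by blast
  define d where "d = ?d"
  have "\<mu> (\<lambda>_. 1) u v = ereal d"
    unfolding \<mu>_def cost
  proof (rule antisym)
    show "(INF es\<in>{es. awalk u es v}. ereal (real (length es))) \<le> ereal d"
      using es by (intro INF_lower2[of es]) (simp_all add: d_def)
    show "ereal d \<le> (INF es\<in>{es. awalk u es v}. ereal (real (length es)))"
      using lower by (intro INF_greatest) (simp add: d_def del: of_nat_le_iff)
  qed
  then show ?thesis
    unfolding graph_dist_def d_def[symmetric] by simp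
qed

section \<open>Characteristic polynomials\<close>

lemma sum_nth_distinct:
  assumes "distinct xs"
  shows "(\<Sum>i<length xs. f (xs ! i)) = sum f (set xs)"
  using sum.reindex_bij_betw[OF bij_betw_nth[OF assms refl refl], of f] by simp

text \<open>Think of \<open>par\<close> as the parent map of a forest on the index set and of \<open>D k\<close> as the subtree
  rooted at \<open>k\<close>.  The functional \<open>f \<mapsto> f l - f (par l)\<close>, or just \<open>f l\<close> if \<open>l\<close> has no parent,
  applied to the indicator of \<open>D k\<close> is 1 if \<open>l = k\<close> and 0 otherwise, since apart from the root a subtree contains a vertex exactly when it
  contains its parent.  Indicators and functionals are thus dual bases.  The second enumeration \<open>ws\<close>
  fixes the order of the new basis, so that the result does not depend on the order \<open>vs\<close> in which the
  matrix was given.\<close>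

lemma char_poly_forest_basis:
  fixes M :: "'v \<Rightarrow> 'v \<Rightarrow> 'a :: field"
  assumes vs: "distinct vs" and ws: "distinct ws" "set ws = set vs"
    and sub: "\<And>k. k \<in> set vs \<Longrightarrow> D k \<subseteq> set vs"
    and par: "\<And>k m. k \<in> set vs \<Longrightarrow> par k = Some m \<Longrightarrow> m \<in> set vs \<and> m \<notin> D k"
    and desc: "\<And>k l. k \<in> set vs \<Longrightarrow> l \<in> set vs \<Longrightarrow>
      l \<in> D k \<longleftrightarrow> l = k \<or> (\<exists>m. par l = Some m \<and> m \<in> D k)"
  shows "char_poly (mat (length vs) (length vs) (\<lambda>(i, j). M (vs ! i) (vs ! j))) =
    char_poly (mat (length ws) (length ws) (\<lambda>(i, j).
      \<Sum>v\<in>D (ws ! j). M (ws ! i) v - (case par (ws ! i) of None \<Rightarrow> 0 | Some m \<Rightarrow> M m v)))"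
proof -
  define N where "N = length vs"
  have N: "length vs = N" "length ws = N"
    using distinct_card[OF vs] distinct_card[OF ws(1)] ws(2) by (simp_all add: N_def)
  have mem: "vs ! i \<in> set vs" "ws ! i \<in> set vs" if "i < N" for i
    using that N ws by (metis nth_mem)+
  define row where "row l f = f l - (case par l of None \<Rightarrow> 0 | Some m \<Rightarrow> f m)" for l and f :: "'v \<Rightarrow> 'a"
  define A where "A = mat N N (\<lambda>(i, j). M (vs ! i) (vs ! j))"
  define B where "B = mat N N (\<lambda>(i, j). \<Sum>v\<in>D (ws ! j). row (ws ! i) (\<lambda>u. M u v))"
  \<comment> \<open>The columns of \<open>P\<close> are the indicators of the subtrees, the rows of \<open>Q\<close> are the functionals.\<close>
  define P where "P = mat N N (\<lambda>(i, j). of_bool (vs ! i \<in> D (ws ! j)) :: 'a)"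
  define Q where "Q = mat N N (\<lambda>(i, j). row (ws ! i) (\<lambda>u. of_bool (u = vs ! j)))"
  have carrier: "A \<in> carrier_mat N N" "B \<in> carrier_mat N N" "P \<in> carrier_mat N N" "Q \<in> carrier_mat N N"
    by (auto simp: A_def B_def P_def Q_def)
  have sum_row: "(\<Sum>u\<in>set vs. row l (\<lambda>u'. of_bool (u' = u)) * g u) = row l g"
    if "l \<in> set vs" for l g
  proof (cases "par l")
    case None
    then show ?thesis using that by (simp add: row_def)
  next
    case (Some m)
    then show ?thesis
      using that par[OF that Some] by (simp add: row_def left_diff_distrib sum_subtractf)
  qed
  have Qmult: "(\<Sum>j<N. Q $$ (i, j) * g (vs ! j)) = row (ws ! i) g" if "i < N" for i g
  proof -
    have "(\<Sum>j<N. Q $$ (i, j) * g (vs ! j)) = (\<Sum>j<length vs. row (ws ! i) (\<lambda>u'. of_bool (u' = vs ! j)) * g (vs ! j))"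
      using that N by (intro sum.cong) (auto simp: Q_def)
    also have "\<dots> = row (ws ! i) g"
      using sum_nth_distinct[OF vs, of "\<lambda>u. row (ws ! i) (\<lambda>u'. of_bool (u' = u)) * g u"]
        sum_row mem that by simp
    finally show ?thesis .
  qed
  have QP: "Q * P = 1\<^sub>m N"
  proof (rule eq_matI)
    fix i j assume ij: "i < dim_row (1\<^sub>m N)" "j < dim_col (1\<^sub>m N)"
    then have "(Q * P) $$ (i, j) = (\<Sum>t<N. Q $$ (i, t) * of_bool (vs ! t \<in> D (ws ! j)))"
      by (auto simp: Q_def P_def scalar_prod_def atLeast0LessThan)
    also have "\<dots> = row (ws ! i) (\<lambda>u. of_bool (u \<in> D (ws ! j)))"
      using Qmult[of i "\<lambda>u. of_bool (u \<in> D (ws ! j))"] ij by simp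
    also have "\<dots> = of_bool (ws ! i = ws ! j)"
      using desc[of "ws ! j" "ws ! i"] par[of "ws ! i"] mem ij
      by (auto simp: row_def split: option.split)
    also have "\<dots> = 1\<^sub>m N $$ (i, j)"
      using ij N ws by (auto simp: nth_eq_iff_index_eq)
    finally show "(Q * P) $$ (i, j) = 1\<^sub>m N $$ (i, j)" .
  qed (use carrier in auto)
  have PQ: "P * Q = 1\<^sub>m N"
    using mat_mult_left_right_inverse[OF carrier(4,3) QP] .
  have AP: "(A * P) $$ (i, j) = (\<Sum>v\<in>D (ws ! j). M (vs ! i) v)" if "i < N" "j < N" for i j
  proof -
    have "(A * P) $$ (i, j) = (\<Sum>t<length vs. M (vs ! i) (vs ! t) * of_bool (vs ! t \<in> D (ws ! j)))"
      using that N by (auto simp: A_def P_def scalar_prod_def atLeast0LessThan)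
    also have "\<dots> = (\<Sum>v\<in>set vs. M (vs ! i) v * of_bool (v \<in> D (ws ! j)))"
      using sum_nth_distinct[OF vs, of "\<lambda>v. M (vs ! i) v * of_bool (v \<in> D (ws ! j))"] .
    also have "\<dots> = (\<Sum>v\<in>set vs \<inter> D (ws ! j). M (vs ! i) v)"
      by (simp add: sum.inter_restrict if_distrib of_bool_def cong: if_cong)
    also have "set vs \<inter> D (ws ! j) = D (ws ! j)"
      using sub[of "ws ! j"] mem that by blast
    finally show ?thesis .
  qed
  have QAP: "Q * (A * P) = B"
  proof (rule eq_matI)
    fix i j assume ij: "i < dim_row B" "j < dim_col B"
    then have ij': "i < N" "j < N" using carrier by auto
    then have "(Q * (A * P)) $$ (i, j) = (\<Sum>t<N. Q $$ (i, t) * (A * P) $$ (t, j))"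
      using carrier by (auto simp: scalar_prod_def atLeast0LessThan)
    also have "\<dots> = (\<Sum>t<N. Q $$ (i, t) * (\<Sum>v\<in>D (ws ! j). M (vs ! t) v))"
      using ij' by (intro sum.cong) (auto simp: AP)
    also have "\<dots> = row (ws ! i) (\<lambda>u. \<Sum>v\<in>D (ws ! j). M u v)"
      using Qmult[of i "\<lambda>u. \<Sum>v\<in>D (ws ! j). M u v"] ij' by simp
    also have "\<dots> = B $$ (i, j)"
      using ij' by (auto simp: B_def row_def sum_subtractf split: option.split)
    finally show "(Q * (A * P)) $$ (i, j) = B $$ (i, j)" .
  qed (use carrier in auto)
  have "P * B = (P * Q) * (A * P)"
    using assoc_mult_mat[OF carrier(3,4), of "A * P" N] carrier QAP by simp
  then have "P * B * Q = A * (P * Q)"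
    using assoc_mult_mat[OF carrier(1,3,4)] carrier PQ by simp
  then have "A = P * B * Q"
    using carrier PQ by simp
  then have "similar_mat A B"
    using carrier PQ QP by (intro similar_matI[of A B P Q N]) auto
  then show ?thesis
    using char_poly_similar by (simp add: A_def B_def N row_def)
qed

lemma char_poly_block_triangular:
  fixes E :: "'v \<Rightarrow> 'v \<Rightarrow> 'a :: idom"
  assumes zero: "\<And>l k. l \<in> set ts \<Longrightarrow> k \<in> set hs \<Longrightarrow> E l k = 0"
    and tri: "sorted_wrt (\<lambda>k l. E l k = 0) ts"
  defines "Mat xs \<equiv> mat (length xs) (length xs) (\<lambda>(i, j). E (xs ! i) (xs ! j))"
  shows "char_poly (Mat (hs @ ts)) = char_poly (Mat hs) * (\<Prod>k\<leftarrow>ts. [:- E k k, 1:])"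
proof -
  define h t where "h = length hs" and "t = length ts"
  define X where "X = mat h t (\<lambda>(i, j). E (hs ! i) (ts ! j))"
  have "char_poly_matrix (Mat (hs @ ts)) =
    four_block_mat (char_poly_matrix (Mat hs)) (map_mat (\<lambda>a. [:- a:]) X)
      (0\<^sub>m t h) (char_poly_matrix (Mat ts))"
    by (rule eq_matI)
      (auto simp: char_poly_matrix_def Mat_def X_def h_def t_def nth_append zero)
  then have "char_poly (Mat (hs @ ts)) = char_poly (Mat hs) * char_poly (Mat ts)"
    unfolding char_poly_def
    by (simp add: det_four_block_mat_lower_left_zero[where n = h and m = t]
        Mat_def X_def h_def t_def)
  also have "char_poly (Mat ts) = (\<Prod>a\<leftarrow>diag_mat (Mat ts). [:- a, 1:])"
    using tri by (intro char_poly_upper_triangular[where n = t])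
      (auto simp: Mat_def t_def upper_triangular_def sorted_wrt_iff_nth_less)
  also have "diag_mat (Mat ts) = map (\<lambda>k. E k k) ts"
    by (auto simp: diag_mat_def Mat_def intro: nth_equalityI)
  finally show ?thesis
    by (simp add: comp_def)
qed

lemma det_3:
  fixes A :: "'a :: comm_ring_1 mat"
  assumes "A \<in> carrier_mat 3 3"
  shows "det A =
    A $$ (0,0) * (A $$ (1,1) * A $$ (2,2) - A $$ (1,2) * A $$ (2,1))
    - A $$ (1,0) * (A $$ (0,1) * A $$ (2,2) - A $$ (0,2) * A $$ (2,1))
    + A $$ (2,0) * (A $$ (0,1) * A $$ (1,2) - A $$ (0,2) * A $$ (1,1))"
proof -
  have det_2: "det B = B $$ (0,0) * B $$ (1,1) - B $$ (1,0) * B $$ (0,1)"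
    if B: "B \<in> carrier_mat 2 2" for B :: "'a mat"
    using B by (subst laplace_expansion_column[OF B, of 0])
      (auto simp: numeral_2_eq_2 cofactor_def det_single mat_delete_def)
  show ?thesis
    using assms by (subst laplace_expansion_column[OF assms, of 0])
      (auto simp: numeral_3_eq_3 numeral_2_eq_2 cofactor_def det_2 mat_delete_def algebra_simps)
qed

lemma char_poly_3:
  fixes f :: "nat \<Rightarrow> nat \<Rightarrow> 'a :: comm_ring_1"
  shows "char_poly (mat 3 3 (\<lambda>(i, j). f i j)) =
    [: - (f 0 0 * (f 1 1 * f 2 2 - f 1 2 * f 2 1) - f 1 0 * (f 0 1 * f 2 2 - f 0 2 * f 2 1)
          + f 2 0 * (f 0 1 * f 1 2 - f 0 2 * f 1 1)),
       (f 0 0 * f 1 1 - f 0 1 * f 1 0) + (f 0 0 * f 2 2 - f 0 2 * f 2 0) + (f 1 1 * f 2 2 - f 1 2 * f 2 1),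
       - (f 0 0 + f 1 1 + f 2 2), 1 :]"
proof -
  let ?A = "char_poly_matrix (mat 3 3 (\<lambda>(i, j). f i j))"
  have A: "?A \<in> carrier_mat 3 3" by simp
  have entry: "?A $$ (i, j) = (if i = j then [:- f i j, 1:] else [:- f i j:])" if "i < 3" "j < 3" for i j
    using that by (simp add: char_poly_matrix_def)
  show ?thesis
    unfolding char_poly_def det_3[OF A]
    by (simp add: entry, simp add: algebra_simps)
qed

section \<open>The generalised distance matrix of the firefly graph\<close>

type_synonym firefly_vertex = "nat + (nat \<times> nat) + (nat \<times> nat)"

text \<open>The triangle number \<open>i\<close> consists of the hub and its two outer vertices \<open>tri i 0\<close> and
  \<open>tri i (Suc 0)\<close>.\<close>

abbreviation hub :: firefly_vertex where "hub \<equiv> Inl 0"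
abbreviation leaf :: "nat \<Rightarrow> firefly_vertex" where "leaf i \<equiv> Inr (Inl (i, 0))"
abbreviation tri :: "nat \<Rightarrow> nat \<Rightarrow> firefly_vertex" where "tri i a \<equiv> Inr (Inr (i, a))"

abbreviation tris :: "nat \<Rightarrow> firefly_vertex set" where
  "tris q \<equiv> (\<lambda>i. tri i 0) ` {..<q} \<union> (\<lambda>i. tri i (Suc 0)) ` {..<q}"

lemma pverts_firefly: "pverts (firefly p q) = {hub} \<union> leaf ` {..<p} \<union> tris q"
  by (auto simp: firefly_def graph_join_def graph_union_def copies_def complete_graph_def
      image_iff less_2_cases_iff)

lemma parcs_firefly:
  "(u, v) \<in> parcs (firefly p q) \<longleftrightarrow> u \<in> pverts (firefly p q) \<and> v \<in> pverts (firefly p q) \<and>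
    u \<noteq> v \<and> (u = hub \<or> v = hub \<or> (\<exists>i a b. u = tri i a \<and> v = tri i b))"
  by (auto simp: firefly_def graph_join_def graph_union_def copies_def complete_graph_def)

lemma sum_tris: "sum f (tris q) = (\<Sum>i<q. f (tri i 0)) + (\<Sum>i<q. f (tri i (Suc 0)))"
  by (subst sum.union_disjoint) (auto simp: sum.reindex inj_on_def)

lemma sum_leaves: "sum f (leaf ` {..<p}) = (\<Sum>i<p. f (leaf i))"
  by (auto simp: sum.reindex inj_on_def)

lemma sum_firefly: "sum f (pverts (firefly p q)) = f hub + (\<Sum>i<p. f (leaf i)) + sum f (tris q)"
  unfolding pverts_firefly
  by (subst sum.union_disjoint, auto, subst sum.insert, auto simp: sum_leaves)

text \<open>Every row of the distance matrix is constant on the leaves, or on the first or second outer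
  vertices of the triangles, with at most one exception; this evaluates all such sums.\<close>

lemma sum_diagonal:
  fixes x y :: real
  assumes "i < m"
  shows "(\<Sum>j<m. if i = j then x else y) = x + (real m - 1) * y"
    and "(\<Sum>j<m. if j = i then x else y) = x + (real m - 1) * y"
proof -
  have "(\<Sum>j<m. if i = j then x else y) = x + (\<Sum>j\<in>{..<m} - {i}. y)"
    using assms by (subst sum.remove[of _ i]) (auto intro!: sum.cong)
  then show "(\<Sum>j<m. if i = j then x else y) = x + (real m - 1) * y"
    using assms by (simp add: of_nat_diff)
  then show "(\<Sum>j<m. if j = i then x else y) = x + (real m - 1) * y"
    by (simp add: eq_commute)
qed

lemma pair_wf_digraph_firefly: "pair_wf_digraph (firefly p q)"
  by unfold_locales (auto simp: parcs_firefly)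

text \<open>Distances and matrix entries are tabulated by the kinds of the two vertices, so that the
  simplifier can evaluate sums of them.\<close>

fun firefly_dist :: "firefly_vertex \<Rightarrow> firefly_vertex \<Rightarrow> real" where
  "firefly_dist (Inl _) (Inl _) = 0"
| "firefly_dist (Inl _) (Inr _) = 1"
| "firefly_dist (Inr _) (Inl _) = 1"
| "firefly_dist (Inr (Inl (i, _))) (Inr (Inl (j, _))) = (if i = j then 0 else 2)"
| "firefly_dist (Inr (Inl _)) (Inr (Inr _)) = 2"
| "firefly_dist (Inr (Inr _)) (Inr (Inl _)) = 2"
| "firefly_dist (Inr (Inr (i, a))) (Inr (Inr (j, b))) = (if i = j then if a = b then 0 else 1 else 2)"

lemma graph_dist_firefly:
  assumes "u \<in> pverts (firefly p q)" "v \<in> pverts (firefly p q)"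
  shows "graph_dist (firefly p q) u v = firefly_dist u v"
proof -
  have "graph_dist (firefly p q) u v =
      (if u = v then 0 else if (u, v) \<in> parcs (firefly p q) then 1 else 2)"
    by (rule graph_dist_universal_vertex[where w = hub, OF pair_wf_digraph_firefly _ _ assms])
      (auto simp: parcs_firefly pverts_firefly)
  then show ?thesis
    using assms by (auto simp: parcs_firefly pverts_firefly split: if_splits)
qed

lemma transmission_firefly:
  "transmission (firefly p q) hub = real p + 2 * real q"
  "i < p \<Longrightarrow> transmission (firefly p q) (leaf i) = 2 * real p + 4 * real q - 1"
  "i < q \<Longrightarrow> a < 2 \<Longrightarrow> transmission (firefly p q) (tri i a) = 2 * real p + 4 * real q - 2"
proof -
  have *: "transmission (firefly p q) v = firefly_dist hub v + (\<Sum>i<p. firefly_dist (leaf i) v)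
      + ((\<Sum>i<q. firefly_dist (tri i 0) v) + (\<Sum>i<q. firefly_dist (tri i (Suc 0)) v))"
    if "v \<in> pverts (firefly p q)" for v
  proof -
    have "transmission (firefly p q) v = (\<Sum>u\<in>pverts (firefly p q). firefly_dist u v)"
      using that by (auto simp: transmission_def graph_dist_firefly)
    then show ?thesis
      by (simp add: sum_firefly sum_tris)
  qed
  show "transmission (firefly p q) hub = real p + 2 * real q"
    by (subst *) (auto simp: pverts_firefly)
  show "transmission (firefly p q) (leaf i) = 2 * real p + 4 * real q - 1" if "i < p"
    using that by (subst *) (auto simp: pverts_firefly sum_diagonal)
  show "transmission (firefly p q) (tri i a) = 2 * real p + 4 * real q - 2" if "i < q" "a < 2"
    using that by (subst *) (auto simp: pverts_firefly sum_diagonal less_2_cases_iff)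
qed

fun firefly_entry :: "real \<Rightarrow> nat \<Rightarrow> nat \<Rightarrow> firefly_vertex \<Rightarrow> firefly_vertex \<Rightarrow> real" where
  "firefly_entry \<alpha> p q (Inl _) (Inl _) = \<alpha> * (real p + 2 * real q)"
| "firefly_entry \<alpha> p q (Inl _) (Inr _) = 1 - \<alpha>"
| "firefly_entry \<alpha> p q (Inr _) (Inl _) = 1 - \<alpha>"
| "firefly_entry \<alpha> p q (Inr (Inl (i, _))) (Inr (Inl (j, _))) =
    (if i = j then \<alpha> * (2 * real p + 4 * real q - 1) else 2 * (1 - \<alpha>))"
| "firefly_entry \<alpha> p q (Inr (Inl _)) (Inr (Inr _)) = 2 * (1 - \<alpha>)"
| "firefly_entry \<alpha> p q (Inr (Inr _)) (Inr (Inl _)) = 2 * (1 - \<alpha>)"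
| "firefly_entry \<alpha> p q (Inr (Inr (i, a))) (Inr (Inr (j, b))) =
    (if i = j then if a = b then \<alpha> * (2 * real p + 4 * real q - 2) else 1 - \<alpha> else 2 * (1 - \<alpha>))"

lemma gen_distance_mat_firefly:
  assumes "distinct vs" "set vs = pverts (firefly p q)"
  shows "gen_distance_mat \<alpha> (firefly p q) vs =
    mat (length vs) (length vs) (\<lambda>(i, j). firefly_entry \<alpha> p q (vs ! i) (vs ! j))"
proof (rule eq_matI)
  fix i j
  assume "i < dim_row (mat (length vs) (length vs) (\<lambda>(i, j). firefly_entry \<alpha> p q (vs ! i) (vs ! j)))"
    and "j < dim_col (mat (length vs) (length vs) (\<lambda>(i, j). firefly_entry \<alpha> p q (vs ! i) (vs ! j)))"
  then have ij: "i < length vs" "j < length vs" by auto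
  then have mem: "vs ! i \<in> pverts (firefly p q)" "vs ! j \<in> pverts (firefly p q)"
    using assms by (metis nth_mem)+
  have "\<alpha> * (if u = v then transmission (firefly p q) u else 0) + (1 - \<alpha>) * graph_dist (firefly p q) u v
      = firefly_entry \<alpha> p q u v" if "u \<in> pverts (firefly p q)" "v \<in> pverts (firefly p q)" for u v
    using that unfolding graph_dist_firefly[OF that]
    by (auto simp: pverts_firefly transmission_firefly split: if_splits)
  from this[OF mem] show "gen_distance_mat \<alpha> (firefly p q) vs $$ (i, j) =
      mat (length vs) (length vs) (\<lambda>(i, j). firefly_entry \<alpha> p q (vs ! i) (vs ! j)) $$ (i, j)"
    using ij assms(1)
    by (cases "i = j") (simp_all add: gen_distance_mat_def transmission_mat_def distance_mat_def mat_diag_def nth_eq_iff_index_eq)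
qed (auto simp: gen_distance_mat_def transmission_mat_def distance_mat_def mat_diag_def)

section \<open>The forest on the firefly graph\<close>

fun firefly_parent :: "firefly_vertex \<Rightarrow> firefly_vertex option" where
  "firefly_parent (Inl _) = None"
| "firefly_parent (Inr (Inl (i, _))) = (if i = 0 then None else Some (leaf 0))"
| "firefly_parent (Inr (Inr (i, a))) =
    (if a \<noteq> 0 then Some (tri i 0) else if i = 0 then None else Some (tri 0 0))"

fun firefly_below :: "nat \<Rightarrow> nat \<Rightarrow> firefly_vertex \<Rightarrow> firefly_vertex set" where
  "firefly_below p q (Inl _) = {hub}"
| "firefly_below p q (Inr (Inl (i, _))) = (if i = 0 then leaf ` {..<p} else {leaf i})"
| "firefly_below p q (Inr (Inr (i, a))) =
    (if a \<noteq> 0 then {tri i a} else if i = 0 then tris q else {tri i 0, tri i (Suc 0)})"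

text \<open>The matrix in the forest basis: the coefficient at the basis vector of \<open>l\<close> of the image of
  the basis vector of \<open>k\<close>.\<close>

definition firefly_reduced :: "real \<Rightarrow> nat \<Rightarrow> nat \<Rightarrow> firefly_vertex \<Rightarrow> firefly_vertex \<Rightarrow> real" where
  "firefly_reduced \<alpha> p q l k = (\<Sum>v\<in>firefly_below p q k. firefly_entry \<alpha> p q l v
     - (case firefly_parent l of None \<Rightarrow> 0 | Some m \<Rightarrow> firefly_entry \<alpha> p q m v))"

lemma char_poly_firefly_forest:
  assumes p: "1 \<le> p" and q: "1 \<le> q"
    and vs: "distinct vs" "set vs = pverts (firefly p q)"
    and ws: "distinct ws" "set ws = pverts (firefly p q)"
  shows "char_poly (gen_distance_mat \<alpha> (firefly p q) vs) =
    char_poly (mat (length ws) (length ws) (\<lambda>(i, j). firefly_reduced \<alpha> p q (ws ! i) (ws ! j)))"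
  unfolding gen_distance_mat_firefly[OF vs] firefly_reduced_def
proof (rule char_poly_forest_basis[OF vs(1) ws(1)])
  show "set ws = set vs" using vs ws by simp
next
  fix k assume k: "k \<in> set vs"
  then show "firefly_below p q k \<subseteq> set vs"
    unfolding vs pverts_firefly by (auto split: if_splits)
  fix m assume "firefly_parent k = Some m"
  then show "m \<in> set vs \<and> m \<notin> firefly_below p q k"
    using p q k unfolding vs pverts_firefly by (auto split: if_splits)
next
  fix k l assume kl: "k \<in> set vs" "l \<in> set vs"
  then show "l \<in> firefly_below p q k \<longleftrightarrow> l = k \<or> (\<exists>m. firefly_parent l = Some m \<and> m \<in> firefly_below p q k)"
    using p q unfolding vs pverts_firefly by (auto split: if_splits)
qed

text \<open>Some symmetry of the matrix that preserves the kind of each vertex (exchanging two leaves, two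
  triangles, or the outer vertices of one triangle) takes a non-root vertex to its parent.  It fixes
  the indicators of the maximal trees, so their images take equal values at both vertices.\<close>

lemma firefly_reduced_tail:
  "\<lbrakk>l \<in> leaf ` {1..<p} \<union> (\<lambda>i. tri i 0) ` {1..<q} \<union> (\<lambda>i. tri i (Suc 0)) ` {0..<q}; k \<in> {hub, leaf 0, tri 0 0}\<rbrakk>
    \<Longrightarrow> firefly_reduced \<alpha> p q l k = 0"
  by (auto simp: firefly_reduced_def sum_leaves sum_tris sum_subtractf sum_diagonal)

text \<open>The second outer vertices have to come last: the rows of \<open>tri i 0\<close> and \<open>tri 0 0\<close> differ at
  the second vertices of the triangles \<open>i\<close> and \<open>0\<close>, which leaves nonzero entries above the
  diagonal.\<close>

lemma firefly_reduced_upper: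
  "sorted_wrt (\<lambda>k l. firefly_reduced \<alpha> p q l k = 0)
    (map leaf [1..<p] @ map (\<lambda>i. tri i 0) [1..<q] @ map (\<lambda>i. tri i (Suc 0)) [0..<q])"
proof -
  have upt: "sorted_wrt R [a..<b]" if "\<And>i j. a \<le> i \<Longrightarrow> i < j \<Longrightarrow> R i j" for R a b
    using that by (intro sorted_wrt_mono_rel[OF _ sorted_wrt_upt]) auto
  show ?thesis
    unfolding sorted_wrt_append sorted_wrt_map
    by (intro conjI upt ballI) (auto simp: firefly_reduced_def sum_subtractf)
qed

lemma firefly_reduced_diagonal:
  "i \<ge> 1 \<Longrightarrow> firefly_reduced \<alpha> p q (leaf i) (leaf i) = (2 * real p + 4 * real q + 1) * \<alpha> - 2"
  "i \<ge> 1 \<Longrightarrow> firefly_reduced \<alpha> p q (tri i 0) (tri i 0) = (2 * real p + 4 * real q + 1) * \<alpha> - 3"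
  "firefly_reduced \<alpha> p q (tri i (Suc 0)) (tri i (Suc 0)) = (2 * real p + 4 * real q - 1) * \<alpha> - 1"
  by (auto simp: firefly_reduced_def algebra_simps)

text \<open>The roots of the forest have no parent to subtract, so these are the row sums of \<open>D\<^sub>\<alpha>\<close> over
  the three kinds of vertices, that is, the quotient matrix of the partition by kind.\<close>

lemma firefly_reduced_quotient:
  assumes "1 \<le> p" "1 \<le> q"
  shows
    "firefly_reduced \<alpha> p q hub hub = \<alpha> * (real p + 2 * real q)"
    "firefly_reduced \<alpha> p q hub (leaf 0) = (1 - \<alpha>) * real p"
    "firefly_reduced \<alpha> p q hub (tri 0 0) = (1 - \<alpha>) * (2 * real q)"
    "firefly_reduced \<alpha> p q (leaf 0) hub = 1 - \<alpha>"
    "firefly_reduced \<alpha> p q (leaf 0) (leaf 0) = \<alpha> * (2 * real p + 4 * real q - 1) + (1 - \<alpha>) * (2 * real p - 2)"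
    "firefly_reduced \<alpha> p q (leaf 0) (tri 0 0) = (1 - \<alpha>) * (4 * real q)"
    "firefly_reduced \<alpha> p q (tri 0 0) hub = 1 - \<alpha>"
    "firefly_reduced \<alpha> p q (tri 0 0) (leaf 0) = (1 - \<alpha>) * (2 * real p)"
    "firefly_reduced \<alpha> p q (tri 0 0) (tri 0 0) = \<alpha> * (2 * real p + 4 * real q - 2) + (1 - \<alpha>) * (4 * real q - 3)"
  using assms
  by (auto simp: firefly_reduced_def sum_leaves sum_tris sum_diagonal algebra_simps)

lemma char_poly_firefly_quotient:
  assumes "1 \<le> p" "1 \<le> q"
  shows "char_poly (mat 3 3 (\<lambda>(i, j).
      firefly_reduced \<alpha> p q ([hub, leaf 0, tri 0 0] ! i) ([hub, leaf 0, tri 0 0] ! j)))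
    = - firefly_cubic (real p + real q) (real p) \<alpha>"
  unfolding char_poly_3
proof -
  let ?f = "\<lambda>i j. firefly_reduced \<alpha> p q ([hub, leaf 0, tri 0 0] ! i) ([hub, leaf 0, tri 0 0] ! j)"
  have f: "?f 0 0 = \<alpha> * (real p + 2 * real q)" "?f 0 1 = (1 - \<alpha>) * real p" "?f 0 2 = (1 - \<alpha>) * (2 * real q)"
    "?f 1 0 = 1 - \<alpha>" "?f 1 1 = \<alpha> * (2 * real p + 4 * real q - 1) + (1 - \<alpha>) * (2 * real p - 2)"
    "?f 1 2 = (1 - \<alpha>) * (4 * real q)" "?f 2 0 = 1 - \<alpha>" "?f 2 1 = (1 - \<alpha>) * (2 * real p)"
    "?f 2 2 = \<alpha> * (2 * real p + 4 * real q - 2) + (1 - \<alpha>) * (4 * real q - 3)"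
    by (simp_all add: firefly_reduced_quotient[OF assms])
  show "[: - (?f 0 0 * (?f 1 1 * ?f 2 2 - ?f 1 2 * ?f 2 1) - ?f 1 0 * (?f 0 1 * ?f 2 2 - ?f 0 2 * ?f 2 1)
          + ?f 2 0 * (?f 0 1 * ?f 1 2 - ?f 0 2 * ?f 1 1)),
       (?f 0 0 * ?f 1 1 - ?f 0 1 * ?f 1 0) + (?f 0 0 * ?f 2 2 - ?f 0 2 * ?f 2 0) + (?f 1 1 * ?f 2 2 - ?f 1 2 * ?f 2 1),
       - (?f 0 0 + ?f 1 1 + ?f 2 2), 1 :] = - firefly_cubic (real p + real q) (real p) \<alpha>"
    unfolding f firefly_cubic_def minus_pCons pCons_eq_iff
    by (intro conjI) (simp_all add: algebra_simps power2_eq_square power3_eq_cube)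
qed

text \<open>The cubic has leading coefficient \<open>- 1\<close>, hence the sign.\<close>

lemma char_poly_firefly:
  assumes p: "1 \<le> p" and q: "1 \<le> q"
    and vs: "distinct vs" "set vs = pverts (firefly p q)"
  shows "char_poly (gen_distance_mat \<alpha> (firefly p q) vs) =
    - firefly_cubic (real p + real q) (real p) \<alpha>
    * [:- ((2 * real p + 4 * real q + 1) * \<alpha> - 2), 1:] ^ (p - 1)
    * [:- ((2 * real p + 4 * real q + 1) * \<alpha> - 3), 1:] ^ (q - 1)
    * [:- ((2 * real p + 4 * real q - 1) * \<alpha> - 1), 1:] ^ q"
proof -
  define hs where "hs = [hub, leaf 0, tri 0 0]"
  define ts where "ts = map leaf [1..<p] @ map (\<lambda>i. tri i 0) [1..<q] @ map (\<lambda>i. tri i (Suc 0)) [0..<q]"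
  have ws: "distinct (hs @ ts)" "set (hs @ ts) = pverts (firefly p q)"
    using p q by (auto simp: hs_def ts_def pverts_firefly distinct_map inj_on_def image_iff Suc_le_eq)
  have prod: "(\<Prod>k\<leftarrow>map f [a..<b]. [:- firefly_reduced \<alpha> p q k k, 1:]) = [:- c, 1:] ^ (b - a)"
    if "\<And>i. a \<le> i \<Longrightarrow> firefly_reduced \<alpha> p q (f i) (f i) = c" for a b c f
  proof -
    have "map ((\<lambda>k. [:- firefly_reduced \<alpha> p q k k, 1:]) \<circ> f) [a..<b] = map (\<lambda>_. [:- c, 1:]) [a..<b]"
      using that by auto
    then show ?thesis
      by (simp add: map_replicate_const)
  qed
  note char_poly_firefly_forest[OF p q vs ws, of \<alpha>]
  also have "char_poly (mat (length (hs @ ts)) (length (hs @ ts))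
        (\<lambda>(i, j). firefly_reduced \<alpha> p q ((hs @ ts) ! i) ((hs @ ts) ! j))) =
      char_poly (mat (length hs) (length hs) (\<lambda>(i, j). firefly_reduced \<alpha> p q (hs ! i) (hs ! j)))
      * (\<Prod>k\<leftarrow>ts. [:- firefly_reduced \<alpha> p q k k, 1:])"
  proof (rule char_poly_block_triangular)
    show "firefly_reduced \<alpha> p q l k = 0" if "l \<in> set ts" "k \<in> set hs" for l k
      using that by (intro firefly_reduced_tail) (auto simp: hs_def ts_def)
  qed (simp only: ts_def firefly_reduced_upper)
  also have "char_poly (mat (length hs) (length hs) (\<lambda>(i, j). firefly_reduced \<alpha> p q (hs ! i) (hs ! j)))
      = - firefly_cubic (real p + real q) (real p) \<alpha>"
    using char_poly_firefly_quotient[OF p q] by (simp add: hs_def numeral_3_eq_3)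
  finally show ?thesis
    unfolding ts_def map_append prod_list.append
    by (simp only: prod[OF firefly_reduced_diagonal(1)] prod[OF firefly_reduced_diagonal(2)]
        prod[OF firefly_reduced_diagonal(3)] mult.assoc minus_nat.diff_0)
qed

section \<open>The spectrum\<close>

theorem theorem4p2:
  fixes n p :: nat and \<alpha> :: real
    and vs :: "(nat + (nat \<times> nat) + (nat \<times> nat)) list"
  assumes "1 \<le> p" and "p \<le> n - 1"
    and "0 \<le> \<alpha>" and "\<alpha> \<le> 1"
    and "distinct vs" and "set vs = pverts (firefly p (n - p))"
  shows "\<exists>l1 l2 l3 :: complex.
    proots (map_poly complex_of_real (firefly_cubic (real n) (real p) \<alpha>)) = {#l1, l2, l3#} \<and>
    gen_distance_spectrum \<alpha> (firefly p (n - p)) vs =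
      replicate_mset (p - 1) (complex_of_real ((4 * real n - 2 * real p + 1) * \<alpha> - 2))
      + replicate_mset (n - p) (complex_of_real ((4 * real n - 2 * real p - 1) * \<alpha> - 1))
      + replicate_mset (n - p - 1) (complex_of_real ((4 * real n - 2 * real p + 1) * \<alpha> - 3))
      + {#l1, l2, l3#}"
proof -
  define q where "q = n - p"
  have pq: "1 \<le> p" "1 \<le> q" and n: "real n = real p + real q"
    using assms by (auto simp: q_def)
  define C where "C = map_poly complex_of_real (firefly_cubic (real n) (real p) \<alpha>)"
  let ?L = "\<lambda>x m. [:- complex_of_real x, 1:] ^ m"
  let ?a = "(4 * real n - 2 * real p + 1) * \<alpha> - 2"
  let ?b = "(4 * real n - 2 * real p - 1) * \<alpha> - 1"
  let ?c = "(4 * real n - 2 * real p + 1) * \<alpha> - 3"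
  interpret of_real_poly: map_poly_comm_ring_hom complex_of_real
    by unfold_locales auto
  have degree: "degree C = 3"
    by (simp add: C_def firefly_cubic_def)
  obtain ls where ls: "proots C = mset ls"
    using ex_mset by metis
  then have "length ls = 3"
    using degree size_proots_complex[of C] by simp
  then obtain l1 l2 l3 where "ls = [l1, l2, l3]"
    by (auto simp: numeral_3_eq_3 length_Suc_conv)
  then have l: "proots C = {#l1, l2, l3#}"
    using ls by simp
  have coeffs: "2 * real p + 4 * real q + 1 = 4 * real n - 2 * real p + 1"
      "2 * real p + 4 * real q - 1 = 4 * real n - 2 * real p - 1"
    by (simp_all add: n)
  have "gen_distance_mat \<alpha> (firefly p q) vs \<in> carrier_mat (length vs) (length vs)"
    by (simp add: gen_distance_mat_def transmission_mat_def distance_mat_def mat_diag_def)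
  then have "char_poly (map_mat complex_of_real (gen_distance_mat \<alpha> (firefly p q) vs)) =
      map_poly complex_of_real (char_poly (gen_distance_mat \<alpha> (firefly p q) vs))"
    by (rule of_real_hom.char_poly_hom)
  also have "\<dots> = - C * ?L ?a (p - 1) * ?L ?c (q - 1) * ?L ?b q"
    unfolding char_poly_firefly[OF pq assms(5) assms(6)[folded q_def]] coeffs C_def n[symmetric]
    by (simp add: of_real_poly.hom_mult of_real_poly.hom_power of_real_poly.hom_uminus)
  finally have "gen_distance_spectrum \<alpha> (firefly p q) vs =
      proots (- C * ?L ?a (p - 1) * ?L ?c (q - 1) * ?L ?b q)"
    by (simp add: gen_distance_spectrum_def eigenvalue_mset_def)
  also have "\<dots> = proots (- C) + replicate_mset (p - 1) (complex_of_real ?a)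
      + replicate_mset (q - 1) (complex_of_real ?c) + replicate_mset q (complex_of_real ?b)"
  proof -
    have linear: "proots (D * [:- x, 1:] ^ m) = proots D + replicate_mset m x"
      if "D \<noteq> 0" for D :: "complex poly" and x m
      using that by (subst proots_mult) (auto simp: proots_power)
    have "- C \<noteq> 0" using degree by auto
    then show ?thesis
      by (simp only: linear mult_eq_0_iff power_eq_0_iff pCons_eq_0_iff one_neq_zero simp_thms)
  qed
  finally show ?thesis
    using l unfolding C_def q_def by (auto simp: ac_simps)
qed

end
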